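(* Let $K$ be an infinite field, $n\ge1$ and $B=(\mu_1,\ldots,\mu_t)$ a partition of $n$. When endomorphisms of $K^n$ are represented by matrices with respect to the ordered basis $\Delta_{B,\prec}$, the variety $\mathcal{SN}_B$ is the affine space of all the strictly upper triangular matrices $A$ such that: i) if $\mu_{q_{i'}}-\mu_{q_i}>l'-l>0$ then the entry of $A\,v^{l'}_{\mu_{q_{i'}},j'}$ with respect to $v^{l}_{\mu_{q_i},j}$ is $0$ (for all basis vectors $v^{l}_{\mu_{q_i},j},v^{l'}_{\mu_{q_{i'}},j'}\in\Delta_B$); ii) for $k\in\{1,\ldots,\mu_{q_1}-1\}$ and $h\in\{1,\ldots,k\}$ the entry of $A_{h,k}$ of indices $(i,j)$ is equal to the entry of $A_{h-1,k-1}$ of indices $(i,j)$, for all indices $(i,j)$ of entries of $A_{h,k}$.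
   Context: Let $B=(\mu_1\ge\cdots\ge\mu_t\ge1)$ be a partition of $n$ and let $0=q_0<q_1<\cdots<q_u=t$ be such that the distinct parts of $B$ are $\mu_{q_1}>\cdots>\mu_{q_u}$ and $\mu_h=\mu_{q_i}$ for $q_{i-1}<h\le q_i$. Let $J$ be the nilpotent matrix in upper triangular Jordan canonical form with Jordan blocks of orders $\mu_1,\ldots,\mu_t$ (in this order). $\Delta_B$ is the canonical basis of $K^n$, written $\Delta_B=\{v^{l}_{\mu_{q_i},j}\ :\ i=1,\ldots,u,\ j=q_i-q_{i-1},\ldots,1,\ l=\mu_{q_i},\ldots,1\}$ in this order: $v^l_{\mu_{q_i},j}$ is the canonical basis vector in position $\mu_{q_i}-l+1$ of the Jordan block number $q_i-j+1$. Hence $Jv^l_{\mu_{q_i},j}=v^{l+1}_{\mu_{q_i},j}$ for $l<\mu_{q_i}$ and $Jv^{\mu_{q_i}}_{\mu_{q_i},j}=0$. $\Delta_{B,\prec}$ is the same basis with the linear order $\prec$ defined by $v^l_{\mu_{q_i},j}\prec v^{l'}_{\mu_{q_{i'}},j'}$ iff either $\mu_{q_i}-l<\mu_{q_{i'}}-l'$; or $\mu_{q_i}-l=\mu_{q_{i'}}-l'$ and $i<i'$; or $\mu_{q_i}-l=\mu_{q_{i'}}-l'$, $i=i'$ and $j<j'$. For $h=0,\ldots,\mu_{q_1}-1$ let $\Delta_{B,h}=\{v^l_{\mu_{q_i},j}\in\Delta_B: \mu_{q_i}-l=h\}$ with the order induced by $\prec$, and let $\pi_h$ be the canonical projection of $K^n$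 onto $\langle\Delta_{B,h}\rangle$ (along the other basis vectors). For an endomorphism $A$ of $K^n$, $A_{h,k}=\pi_h\circ A|_{\langle\Delta_{B,k}\rangle}$, as a matrix with respect to $\Delta_{B,k}$ and $\Delta_{B,h}$, for $h,k\in\{0,\ldots,\mu_{q_1}-1\}$. (One has $|\Delta_{B,h}|\ge|\Delta_{B,h'}|$ if $h<h'$.) Definition of $\mathcal{SN}_B$: write a matrix (with respect to $\Delta_B$) as $X=(X_{h,k}^{\rm blk})_{h,k=1,\ldots,t}$ with blocks of size $\mu_h\times\mu_k$. If $A$ commutes with $J$, then for $q_{i-1}<h,k\le q_i$ the block $A^{\rm blk}_{h,k}$ is an upper triangular Toeplitz matrix of order $\mu_{q_i}$; let $A(i)$ be the square matrix of order $q_i-q_{i-1}$ whose entries are the (constant) diagonal entries of the blocks $A^{\rm blk}_{h,k}$, $q_{i-1}+1\le h,k\le q_i$. $\mathcal{SN}_B$ is the set of all nilpotent $A\in M(n,K)$ commuting with $J$ such that $A(i)$ is lower triangular for $i=1,\ldots,u$. *)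

theory Defs
  imports
    "Jordan_Normal_Form.Jordan_Normal_Form"
    "Jordan_Normal_Form.VS_Connect"
begin

definition is_partition :: "nat list \<Rightarrow> nat \<Rightarrow> bool" where
  "is_partition mu n \<longleftrightarrow>
     sorted_wrt (\<ge>) mu \<and> (\<forall>m \<in> set mu. 1 \<le> m) \<and> sum_list mu = n"

text \<open>Parts, blocks and the indices \<open>i\<close> of \<open>q\<^sub>i\<close> are numbered from 1 as in the mathematical text;
  positions in lists, vectors and matrices are numbered from 0.\<close>

definition mu_part :: "nat list \<Rightarrow> nat \<Rightarrow> nat" where
  "mu_part mu h = mu ! (h - 1)"

definition distinct_part_indices :: "nat list \<Rightarrow> (nat \<Rightarrow> nat) \<Rightarrow> nat \<Rightarrow> bool" where
  "distinct_part_indices mu q u \<longleftrightarrow>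
     q 0 = 0 \<and> q u = length mu \<and>
     (\<forall>i<u. q i < q (Suc i)) \<and>
     (\<forall>i\<in>{1..<u}. mu_part mu (q i) > mu_part mu (q (Suc i))) \<and>
     (\<forall>i\<in>{1..u}. \<forall>h. q (i - 1) < h \<and> h \<le> q i \<longrightarrow> mu_part mu h = mu_part mu (q i))"

definition J_mat :: "nat list \<Rightarrow> 'a :: field mat" where
  "J_mat mu = jordan_matrix (map (\<lambda>m. (m, 0)) mu)"

definition block_start :: "nat list \<Rightarrow> nat \<Rightarrow> nat" where
  "block_start mu h = sum_list (take (h - 1) mu)"

text \<open>The triple \<open>(i, j, l)\<close> stands for the basis vector $v^l_{\mu_{q_i},j}$.\<close>

type_synonym label = "nat \<times> nat \<times> nat"

definition Delta :: "nat list \<Rightarrow> (nat \<Rightarrow> nat) \<Rightarrow> nat \<Rightarrow> label set" where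
  "Delta mu q u =
     {(i, j, l). i \<in> {1..u} \<and> j \<in> {1..q i - q (i - 1)} \<and> l \<in> {1..mu_part mu (q i)}}"

fun position :: "nat list \<Rightarrow> (nat \<Rightarrow> nat) \<Rightarrow> label \<Rightarrow> nat" where
  "position mu q (i, j, l) = block_start mu (q i - j + 1) + (mu_part mu (q i) - l)"

definition basis_vec :: "nat list \<Rightarrow> (nat \<Rightarrow> nat) \<Rightarrow> label \<Rightarrow> 'a :: field vec" where
  "basis_vec mu q x = unit_vec (sum_list mu) (position mu q x)"

text \<open>As the basis vectors are the canonical ones, the coordinate of a vector with respect to
  \<open>basis_vec mu q x\<close> is its component at \<open>position mu q x\<close>.\<close>

definition coord :: "nat list \<Rightarrow> (nat \<Rightarrow> nat) \<Rightarrow> label \<Rightarrow> 'a :: field vec \<Rightarrow> 'a" where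
  "coord mu q x w = w $ position mu q x"

fun level :: "nat list \<Rightarrow> (nat \<Rightarrow> nat) \<Rightarrow> label \<Rightarrow> nat" where
  "level mu q (i, j, l) = mu_part mu (q i) - l"

fun prec :: "nat list \<Rightarrow> (nat \<Rightarrow> nat) \<Rightarrow> label \<Rightarrow> label \<Rightarrow> bool" where
  "prec mu q (i, j, l) (i', j', l') \<longleftrightarrow>
     mu_part mu (q i) - l < mu_part mu (q i') - l' \<or>
     mu_part mu (q i) - l = mu_part mu (q i') - l' \<and> i < i' \<or>
     mu_part mu (q i) - l = mu_part mu (q i') - l' \<and> i = i' \<and> j < j'"

definition Delta_prec :: "nat list \<Rightarrow> (nat \<Rightarrow> nat) \<Rightarrow> nat \<Rightarrow> label list" where
  "Delta_prec mu q u = (THE xs. set xs = Delta mu q u \<and> sorted_wrt (prec mu q) xs)"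

definition Delta_level :: "nat list \<Rightarrow> (nat \<Rightarrow> nat) \<Rightarrow> nat \<Rightarrow> nat \<Rightarrow> label list" where
  "Delta_level mu q u h = filter (\<lambda>x. level mu q x = h) (Delta_prec mu q u)"

lemma sorted_wrt_list_ex1:
  assumes "finite S"
    and asym: "\<And>x y. x \<in> S \<Longrightarrow> y \<in> S \<Longrightarrow> R x y \<Longrightarrow> \<not> R y x"
    and trans: "\<And>x y z. x \<in> S \<Longrightarrow> y \<in> S \<Longrightarrow> z \<in> S \<Longrightarrow> R x y \<Longrightarrow> R y z \<Longrightarrow> R x z"
    and total: "\<And>x y. x \<in> S \<Longrightarrow> y \<in> S \<Longrightarrow> x \<noteq> y \<Longrightarrow> R x y \<or> R y x"
  shows "\<exists>!xs. set xs = S \<and> sorted_wrt R xs"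
  using assms
proof (induction "card S" arbitrary: S)
  case 0
  have "S = {}" using 0(1) 0(2) by simp
  then show ?case by (simp add: Ex1_def)
next
  case (Suc n)
  have "\<exists>m\<in>S. \<forall>y\<in>S. y \<noteq> m \<longrightarrow> R m y" if "finite S" "S \<noteq> {}"
      "\<And>x y z. x \<in> S \<Longrightarrow> y \<in> S \<Longrightarrow> z \<in> S \<Longrightarrow> R x y \<Longrightarrow> R y z \<Longrightarrow> R x z"
      "\<And>x y. x \<in> S \<Longrightarrow> y \<in> S \<Longrightarrow> x \<noteq> y \<Longrightarrow> R x y \<or> R y x" for S
    using that
  proof (induction S rule: finite_ne_induct)
    case (singleton x)
    show ?case by simp
  next
    case (insert x F)
    have "\<exists>m\<in>F. \<forall>y\<in>F. y \<noteq> m \<longrightarrow> R m y"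
    proof (rule insert.IH)
      show "R x' z" if "x' \<in> F" "y \<in> F" "z \<in> F" "R x' y" "R y z" for x' y z
        using insert.prems(1)[of x' y z] that by simp
      show "R x' y \<or> R y x'" if "x' \<in> F" "y \<in> F" "x' \<noteq> y" for x' y
        using insert.prems(2)[of x' y] that by simp
    qed
    then obtain m where m: "m \<in> F" "\<forall>y\<in>F. y \<noteq> m \<longrightarrow> R m y" by blast
    have "x \<noteq> m" using insert.hyps m by auto
    then have "R x m \<or> R m x" using insert.prems(2)[of x m] m by auto
    then show ?case
    proof
      assume "R x m"
      then have "\<forall>y\<in>insert x F. y \<noteq> x \<longrightarrow> R x y"
        using m insert.prems(1)[of x m] by (metis insertI1 insertI2 insertE)
      then show ?thesis by blast
    next
      assume "R m x"
      then show ?thesis using m by blast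
    qed
  qed
  note ex_min = this
  have "S \<noteq> {}" using Suc.hyps(2) by auto
  then have "\<exists>m\<in>S. \<forall>y\<in>S. y \<noteq> m \<longrightarrow> R m y"
    using ex_min[OF Suc.prems(1) _ Suc.prems(3,4)] by simp
  then obtain m where m: "m \<in> S" "\<forall>y\<in>S. y \<noteq> m \<longrightarrow> R m y" by blast
  have "\<exists>!xs. set xs = S - {m} \<and> sorted_wrt R xs"
  proof (rule Suc.hyps(1))
    show "n = card (S - {m})" using Suc.hyps(2) Suc.prems(1) m(1) by simp
    show "finite (S - {m})" using Suc.prems(1) by simp
    show "\<not> R y x" if "x \<in> S - {m}" "y \<in> S - {m}" "R x y" for x y
      using Suc.prems(2)[of x y] that by simp
    show "R x z" if "x \<in> S - {m}" "y \<in> S - {m}" "z \<in> S - {m}" "R x y" "R y z" for x y z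
      using Suc.prems(3)[of x y z] that by simp
    show "R x y \<or> R y x" if "x \<in> S - {m}" "y \<in> S - {m}" "x \<noteq> y" for x y
      using Suc.prems(4)[of x y] that by simp
  qed
  then obtain xs where xs: "set xs = S - {m} \<and> sorted_wrt R xs"
    and uniq: "\<forall>ys. set ys = S - {m} \<and> sorted_wrt R ys \<longrightarrow> ys = xs"
    by (rule ex1E)
  show ?case
  proof (rule ex1I[of _ "m # xs"])
    show "set (m # xs) = S \<and> sorted_wrt R (m # xs)" using xs m by auto
  next
    fix ys assume ys: "set ys = S \<and> sorted_wrt R ys"
    then obtain z zs where z: "ys = z # zs" using m by (cases ys) auto
    have zS: "z \<in> S" and sub: "set zs \<subseteq> S" and Rz: "\<forall>y\<in>set zs. R z y" and szs: "sorted_wrt R zs"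
      using ys z by auto
    have nz: "z \<notin> set zs" using Rz Suc.prems(2)[OF zS zS] by blast
    have "z = m"
    proof (rule ccontr)
      assume "z \<noteq> m"
      then have "R z m" "R m z" using Rz ys z m zS by auto
      then show False using Suc.prems(2)[OF zS m(1)] by blast
    qed
    moreover have "set zs = S - {m}" using nz ys z \<open>z = m\<close> by auto
    then have "zs = xs" using uniq szs by blast
    ultimately show "ys = m # xs" using z by simp
  qed
qed

lemma finite_Delta: "finite (Delta mu q u)"
proof -
  have "Delta mu q u =
      (SIGMA i:{1..u}. {1..q i - q (i - 1)} \<times> {1..mu_part mu (q i)})"
    unfolding Delta_def by auto
  then show ?thesis by simp
qed

lemma Delta_prec_ex1: "\<exists>!xs. set xs = Delta mu q u \<and> sorted_wrt (prec mu q) xs"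
proof (rule sorted_wrt_list_ex1[OF finite_Delta])
  have key: "prec mu q x y \<longleftrightarrow>
      level mu q x < level mu q y \<or>
      level mu q x = level mu q y \<and> fst x < fst y \<or>
      level mu q x = level mu q y \<and> fst x = fst y \<and> fst (snd x) < fst (snd y)" for x y
    by (cases x rule: prod_cases3; cases y rule: prod_cases3)
      (simp only: prec.simps level.simps fst_conv snd_conv)
  show "\<not> prec mu q y x" if "prec mu q x y" for x y
    using that unfolding key by linarith
  show "prec mu q x z" if "prec mu q x y" "prec mu q y z" for x y z
    using that unfolding key by linarith
  show "prec mu q x y \<or> prec mu q y x"
    if "x \<in> Delta mu q u" "y \<in> Delta mu q u" "x \<noteq> y" for x y
  proof (rule ccontr)
    assume neg: "\<not> (prec mu q x y \<or> prec mu q y x)"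
    obtain i j l i' j' l' where xy: "x = (i, j, l)" "y = (i', j', l')" by (metis prod_cases3)
    have eqs: "mu_part mu (q i) - l = mu_part mu (q i') - l'" "i = i'" "j = j'"
      using neg unfolding xy by auto
    have "l \<le> mu_part mu (q i)" "l' \<le> mu_part mu (q i')"
      using that unfolding xy Delta_def by auto
    then have "l = l'" using eqs by simp
    then show False using that(3) eqs xy by simp
  qed
qed

text \<open>An endomorphism of $K^n$ is given by its matrix \<open>A\<close> with respect to the canonical basis.\<close>

definition entry :: "nat list \<Rightarrow> (nat \<Rightarrow> nat) \<Rightarrow> 'a :: field mat \<Rightarrow> label \<Rightarrow> label \<Rightarrow> 'a" where
  "entry mu q A x y = coord mu q x (A *\<^sub>v basis_vec mu q y)"

definition matrix_prec :: "nat list \<Rightarrow> (nat \<Rightarrow> nat) \<Rightarrow> nat \<Rightarrow> 'a :: field mat \<Rightarrow> 'a mat" where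
  "matrix_prec mu q u A =
     (let D = Delta_prec mu q u
      in mat (length D) (length D) (\<lambda>(a, b). entry mu q A (D ! a) (D ! b)))"

definition proj :: "nat list \<Rightarrow> (nat \<Rightarrow> nat) \<Rightarrow> nat \<Rightarrow> nat \<Rightarrow> 'a :: field vec \<Rightarrow> 'a vec" where
  "proj mu q u h w =
     vec (sum_list mu) (\<lambda>p. if p \<in> position mu q ` set (Delta_level mu q u h) then w $ p else 0)"

definition level_block ::
    "nat list \<Rightarrow> (nat \<Rightarrow> nat) \<Rightarrow> nat \<Rightarrow> 'a :: field mat \<Rightarrow> nat \<Rightarrow> nat \<Rightarrow> 'a mat" where
  "level_block mu q u A h k =
     (let Dh = Delta_level mu q u h; Dk = Delta_level mu q u k
      in mat (length Dh) (length Dk)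
           (\<lambda>(a, b). coord mu q (Dh ! a) (proj mu q u h (A *\<^sub>v basis_vec mu q (Dk ! b)))))"

definition strictly_upper_triangular :: "'a :: zero mat \<Rightarrow> bool" where
  "strictly_upper_triangular A \<longleftrightarrow> (\<forall>a < dim_row A. \<forall>b < dim_col A. b \<le> a \<longrightarrow> A $$ (a, b) = 0)"

definition is_lower_triangular :: "'a :: zero mat \<Rightarrow> bool" where
  "is_lower_triangular A \<longleftrightarrow> (\<forall>a < dim_row A. \<forall>b < dim_col A. a < b \<longrightarrow> A $$ (a, b) = 0)"

definition blk :: "nat list \<Rightarrow> 'a :: field mat \<Rightarrow> nat \<Rightarrow> nat \<Rightarrow> 'a mat" where
  "blk mu X h k =
     mat (mu_part mu h) (mu_part mu k) (\<lambda>(r, s). X $$ (block_start mu h + r, block_start mu k + s))"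

text \<open>For \<open>A\<close> commuting with \<open>J_mat mu\<close> the blocks below are Toeplitz, so their
  constant diagonal entry can be read off at \<open>(0, 0)\<close>.\<close>

definition diag_mat_of :: "nat list \<Rightarrow> (nat \<Rightarrow> nat) \<Rightarrow> 'a :: field mat \<Rightarrow> nat \<Rightarrow> 'a mat" where
  "diag_mat_of mu q A i =
     mat (q i - q (i - 1)) (q i - q (i - 1))
       (\<lambda>(a, b). blk mu A (q (i - 1) + 1 + a) (q (i - 1) + 1 + b) $$ (0, 0))"

definition nilpotent_mat :: "'a :: field mat \<Rightarrow> bool" where
  "nilpotent_mat A \<longleftrightarrow> (\<exists>m. A ^\<^sub>m m = 0\<^sub>m (dim_row A) (dim_row A))"

definition SN :: "nat list \<Rightarrow> (nat \<Rightarrow> nat) \<Rightarrow> nat \<Rightarrow> 'a :: field mat set" where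
  "SN mu q u =
     {A \<in> carrier_mat (sum_list mu) (sum_list mu).
        nilpotent_mat A \<and> A * J_mat mu = J_mat mu * A \<and>
        (\<forall>i\<in>{1..u}. is_lower_triangular (diag_mat_of mu q A i))}"

end

theory Submission
  imports Defs
begin

text \<open>
  Read in terms of basis labels, the commutation \<open>A J = J A\<close> means that the entry of \<open>A\<close> in row
  \<open>(i, j, l)\<close> and column \<open>(i', j', l')\<close> is unchanged when \<open>l\<close> and \<open>l'\<close> are raised together, with zeros at
  the ends of the blocks (\<open>commutes_J_mat_iff\<close>). Moving an entry to the end of its block shows that it
  vanishes if \<open>l < l'\<close> and also if the level of the row exceeds the level of the column
  (\<open>commuting_entry_eq_0\<close>).

  Let \<open>A\<close> commute with \<open>J\<close>, let the matrices \<open>A(i)\<close> be lower triangular, and order the basis by \<open>prec\<close>. An entry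
  below the diagonal has a higher row level than column level, or equal levels and a larger part for the
  column, hence \<open>l < l'\<close>, or it comes from the upper part of some \<open>A(i)\<close>, since \<open>j\<close> numbers equal blocks in
  reverse. In each case it is 0, so \<open>A\<close> is upper triangular, and such a matrix is nilpotent iff its
  diagonal vanishes (\<open>nilpotent_upper_triangular_iff\<close>). Condition i) is part of the vanishing for
  \<open>l < l'\<close>.

  Conversely, the vanishing needed at the ends of the blocks is given by strict triangularity
  unless the row level is smaller than the column level, where it is condition i); below the
  diagonal blocks of levels the shift invariance holds because both entries are 0, elsewhere it is
  condition ii). For the latter, the point is that the list of labels of level \<open>h\<close>, shifted, is an
  initial segment of the list of labels of level \<open>h - 1\<close> (\<open>Delta_level_shift\<close>), so that equal matrix
  indices in \<open>A\<^bsub>h,k\<^esub>\<close> and \<open>A\<^bsub>h-1,k-1\<^esub>\<close> belong to shifted labels.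

  All conditions so obtained are homogeneous linear equations in the entries, and passing to the matrix in the
  ordered basis is linear; hence the subspace.
\<close>

section \<open>Positions in a block decomposition\<close>

text \<open>An index below \<open>sum_list mu\<close> is uniquely of the form \<open>sum_list (take b mu) + p\<close> with
  \<open>p < mu ! b\<close>: it is the position \<open>p\<close> in the block \<open>b\<close>, both counted from 0.\<close>

lemma block_offset_inj:
  fixes mu :: "nat list"
  assumes "b < length mu" "p < mu ! b" "b' < length mu" "p' < mu ! b'"
    and "sum_list (take b mu) + p = sum_list (take b' mu) + p'"
  shows "b = b' \<and> p = p'"
  using assms
proof (induction mu arbitrary: b b')
  case (Cons m mu)
  show ?case
  proof (cases b)
    case 0
    then show ?thesis using Cons.prems by (cases b') simp_all
  next
    case (Suc c)
    then show ?thesis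
    proof (cases b')
      case 0
      then show ?thesis using Cons.prems Suc by simp
    next
      case (Suc c')
      then have "c = c' \<and> p = p'"
        using Cons.prems \<open>b = Suc c\<close> by (intro Cons.IH) simp_all
      then show ?thesis using Suc \<open>b = Suc c\<close> by simp
    qed
  qed
qed simp

lemma block_offset_surj:
  fixes mu :: "nat list"
  assumes "r < sum_list mu"
  shows "\<exists>b p. b < length mu \<and> p < mu ! b \<and> r = sum_list (take b mu) + p"
  using assms
proof (induction mu arbitrary: r)
  case (Cons m mu)
  show ?case
  proof (cases "r < m")
    case True
    then show ?thesis by (intro exI[of _ 0] exI[of _ r]) simp
  next
    case False
    then have "r - m < sum_list mu" using Cons.prems by simp
    then obtain b p where "b < length mu" "p < mu ! b" "r - m = sum_list (take b mu) + p"
      using Cons.IH by blast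
    then show ?thesis using False by (intro exI[of _ "Suc b"] exI[of _ p]) simp
  qed
qed simp

lemma block_offset_less:
  fixes mu :: "nat list"
  assumes "b < length mu" "p < mu ! b"
  shows "sum_list (take b mu) + p < sum_list mu"
  using assms
proof (induction mu arbitrary: b)
  case (Cons m mu)
  then show ?case by (cases b) (auto simp: trans_less_add1)
qed simp

lemma J_mat_dim [simp]:
  "dim_row (J_mat mu) = sum_list mu" "dim_col (J_mat mu) = sum_list mu"
  by (simp_all add: J_mat_def o_def)

lemma J_mat_carrier: "J_mat mu \<in> carrier_mat (sum_list mu) (sum_list mu)"
  by (intro carrier_matI) simp_all

lemma J_mat_entry:
  assumes "b < length mu" "p < mu ! b" "b' < length mu" "p' < mu ! b'"
  shows "(J_mat mu :: 'a :: field mat) $$ (sum_list (take b mu) + p, sum_list (take b' mu) + p') =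
           (if b = b' \<and> p' = Suc p then 1 else 0)"
  using assms
proof (induction mu arbitrary: b b')
  case (Cons m mu)
  have Cons_J: "(J_mat (m # mu) :: 'a mat) = four_block_mat (jordan_block m 0) (0\<^sub>m m (sum_list mu))
      (0\<^sub>m (sum_list mu) m) (J_mat mu)"
    by (simp add: J_mat_def jordan_matrix_Cons o_def)
  have less: "sum_list (take (b - 1) mu) + p < sum_list mu" if "b \<noteq> 0"
    using block_offset_less[of "b - 1" mu p] Cons.prems that by (cases b) auto
  have less': "sum_list (take (b' - 1) mu) + p' < sum_list mu" if "b' \<noteq> 0"
    using block_offset_less[of "b' - 1" mu p'] Cons.prems that by (cases b') auto
  show ?case
    using Cons.prems Cons.IH[of "b - 1" "b' - 1"] less less' unfolding Cons_J
    by (cases b; cases b') (auto simp: add.assoc)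
qed simp

section \<open>Nilpotent triangular matrices\<close>

lemma pow_mat_upper_triangular:
  fixes T :: "'a :: field mat"
  assumes T: "T \<in> carrier_mat n n" and ut: "upper_triangular T"
  shows "upper_triangular (T ^\<^sub>m k) \<and> (\<forall>a<n. (T ^\<^sub>m k) $$ (a, a) = T $$ (a, a) ^ k)"
proof (induction k)
  case 0
  show ?case using T by auto
next
  case (Suc k)
  have P: "T ^\<^sub>m k \<in> carrier_mat n n" using T by (rule pow_carrier_mat)
  have ent: "(T ^\<^sub>m Suc k) $$ (a, b) = (\<Sum>c\<in>{0..<n}. (T ^\<^sub>m k) $$ (a, c) * T $$ (c, b))"
    if "a < n" "b < n" for a b
    using that T P by (simp add: scalar_prod_def)
  have zP: "(T ^\<^sub>m k) $$ (a, c) = 0" if "c < a" "a < n" for a c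
    using Suc.IH that P by (auto simp del: pow_mat.simps)
  have zT: "T $$ (a, c) = 0" if "c < a" "a < n" for a c
    using ut that T by auto
  show ?case
  proof (intro conjI allI impI upper_triangularI)
    fix a b assume ab: "b < a" "a < dim_row (T ^\<^sub>m Suc k)"
    have "dim_row (T ^\<^sub>m Suc k) = n" using pow_carrier_mat[OF T, of "Suc k"] by (rule carrier_matD)
    then have "a < n" using ab by simp
    have "(T ^\<^sub>m k) $$ (a, c) * T $$ (c, b) = 0" if "c < n" for c
      using zP[of c a] zT[of b c] that ab \<open>a < n\<close> by (cases "c < a") auto
    then have "(\<Sum>c\<in>{0..<n}. (T ^\<^sub>m k) $$ (a, c) * T $$ (c, b)) = 0"
      by (intro sum.neutral) simp
    then show "(T ^\<^sub>m Suc k) $$ (a, b) = 0" using ent[of a b] ab \<open>a < n\<close> by simp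
  next
    fix a assume a: "a < n"
    have "(\<Sum>c\<in>{0..<n}. (T ^\<^sub>m k) $$ (a, c) * T $$ (c, a)) =
        (\<Sum>c\<in>{0..<n}. if c = a then (T ^\<^sub>m k) $$ (a, a) * T $$ (a, a) else 0)"
    proof (rule sum.cong[OF refl])
      fix c assume c: "c \<in> {0..<n}"
      have "(T ^\<^sub>m k) $$ (a, c) * T $$ (c, a) = 0" if "c \<noteq> a"
        using that zP[of c a] zT[of a c] a c by (cases "c < a") (simp_all del: pow_mat.simps)
      then show "(T ^\<^sub>m k) $$ (a, c) * T $$ (c, a) =
          (if c = a then (T ^\<^sub>m k) $$ (a, a) * T $$ (a, a) else 0)"
        by (cases "c = a") (simp_all del: pow_mat.simps)
    qed
    then show "(T ^\<^sub>m Suc k) $$ (a, a) = T $$ (a, a) ^ Suc k"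
      using ent[of a a] a Suc.IH by (simp add: power_Suc2 del: pow_mat.simps power_Suc)
  qed
qed

lemma pow_mat_strictly_upper_triangular:
  fixes T :: "'a :: field mat"
  assumes T: "T \<in> carrier_mat n n" and sut: "strictly_upper_triangular T"
  shows "a < n \<Longrightarrow> b < n \<Longrightarrow> b < a + k \<Longrightarrow> (T ^\<^sub>m k) $$ (a, b) = 0"
proof (induction k arbitrary: b)
  case 0
  then show ?case using T by simp
next
  case (Suc k)
  have P: "T ^\<^sub>m k \<in> carrier_mat n n" using T by (rule pow_carrier_mat)
  have "(T ^\<^sub>m Suc k) $$ (a, b) = (\<Sum>c\<in>{0..<n}. (T ^\<^sub>m k) $$ (a, c) * T $$ (c, b))"
    using Suc.prems T P by (simp add: scalar_prod_def)
  also have "\<dots> = 0"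
  proof (rule sum.neutral, rule ballI)
    fix c assume c: "c \<in> {0..<n}"
    show "(T ^\<^sub>m k) $$ (a, c) * T $$ (c, b) = 0"
    proof (cases "c < a + k")
      case True
      then show ?thesis using Suc.IH[of c] Suc.prems c by simp
    next
      case False
      then have "T $$ (c, b) = 0"
        using sut T c Suc.prems unfolding strictly_upper_triangular_def by auto
      then show ?thesis by simp
    qed
  qed
  finally show ?case .
qed

lemma nilpotent_upper_triangular_iff:
  fixes T :: "'a :: field mat"
  assumes T: "T \<in> carrier_mat n n" and ut: "upper_triangular T"
  shows "nilpotent_mat T \<longleftrightarrow> strictly_upper_triangular T"
proof
  assume "nilpotent_mat T"
  then obtain k where k: "T ^\<^sub>m k = 0\<^sub>m n n" using T unfolding nilpotent_mat_def by auto
  have "T $$ (a, a) = 0" if "a < n" for a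
    using pow_mat_upper_triangular[OF T ut, of k] that unfolding k by auto
  then show "strictly_upper_triangular T"
    using ut T unfolding strictly_upper_triangular_def by (auto simp: le_less)
next
  assume "strictly_upper_triangular T"
  then have "T ^\<^sub>m n = 0\<^sub>m n n"
    using pow_mat_strictly_upper_triangular[OF T, of _ _ n] T by (intro eq_matI) auto
  then show "nilpotent_mat T" using T unfolding nilpotent_mat_def by auto
qed

section \<open>Simultaneous permutation of rows and columns\<close>

text \<open>The matrix of \<open>A\<close> after renumbering the canonical basis: the new basis vector number \<open>a\<close> is the old
  one number \<open>f a\<close>. It is the conjugate of \<open>A\<close> by a permutation matrix when \<open>f\<close> permutes
  \<open>{..<n}\<close>.\<close>

definition reindex_mat :: "nat \<Rightarrow> (nat \<Rightarrow> nat) \<Rightarrow> 'a mat \<Rightarrow> 'a mat" where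
  "reindex_mat n f A = mat n n (\<lambda>(a, b). A $$ (f a, f b))"

lemma reindex_mat_carrier [simp]: "reindex_mat n f A \<in> carrier_mat n n"
  by (simp add: reindex_mat_def)

lemma reindex_mat_mult:
  fixes A B :: "'a :: field mat"
  assumes f: "bij_betw f {..<n} {..<n}"
    and A: "A \<in> carrier_mat n n" and B: "B \<in> carrier_mat n n"
  shows "reindex_mat n f (A * B) = reindex_mat n f A * reindex_mat n f B"
proof (rule eq_matI)
  have flt: "f a < n" if "a < n" for a using f that unfolding bij_betw_def by auto
  fix a b assume "a < dim_row (reindex_mat n f A * reindex_mat n f B)"
    "b < dim_col (reindex_mat n f A * reindex_mat n f B)"
  then have ab: "a < n" "b < n" by (simp_all add: reindex_mat_def)
  have "reindex_mat n f (A * B) $$ (a, b) = (\<Sum>c\<in>{..<n}. A $$ (f a, c) * B $$ (c, f b))"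
    using ab flt A B by (simp add: reindex_mat_def scalar_prod_def atLeast0LessThan)
  also have "\<dots> = (\<Sum>c\<in>{..<n}. A $$ (f a, f c) * B $$ (f c, f b))"
    by (rule sum.reindex_bij_betw[OF f, symmetric])
  also have "\<dots> = (reindex_mat n f A * reindex_mat n f B) $$ (a, b)"
    using ab by (simp add: reindex_mat_def scalar_prod_def atLeast0LessThan)
  finally show "reindex_mat n f (A * B) $$ (a, b) = (reindex_mat n f A * reindex_mat n f B) $$ (a, b)" .
qed (simp_all add: reindex_mat_def)

lemma reindex_mat_pow:
  fixes A :: "'a :: field mat"
  assumes f: "bij_betw f {..<n} {..<n}" and A: "A \<in> carrier_mat n n"
  shows "reindex_mat n f (A ^\<^sub>m k) = reindex_mat n f A ^\<^sub>m k"
proof (induction k)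
  case 0
  have "f a < n" if "a < n" for a using f that unfolding bij_betw_def by auto
  moreover have "f a = f b \<longleftrightarrow> a = b" if "a < n" "b < n" for a b
    using f that unfolding bij_betw_def inj_on_def by auto
  ultimately show ?case using A by (intro eq_matI) (auto simp: reindex_mat_def)
next
  case (Suc k)
  then show ?case using reindex_mat_mult[OF f pow_carrier_mat[OF A] A] by simp
qed

lemma reindex_mat_eq_0_iff:
  assumes f: "bij_betw f {..<n} {..<n}" and A: "A \<in> carrier_mat n n"
  shows "reindex_mat n f A = 0\<^sub>m n n \<longleftrightarrow> A = 0\<^sub>m n n"
proof
  assume R: "reindex_mat n f A = 0\<^sub>m n n"
  show "A = 0\<^sub>m n n"
  proof (rule eq_matI)
    fix r s assume "r < dim_row (0\<^sub>m n n :: 'a mat)" "s < dim_col (0\<^sub>m n n :: 'a mat)"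
    then have "r \<in> f ` {..<n}" "s \<in> f ` {..<n}"
      using bij_betw_imp_surj_on[OF f] by simp_all
    then obtain a b where "a < n" "b < n" "r = f a" "s = f b" by auto
    then show "A $$ (r, s) = 0\<^sub>m n n $$ (r, s)"
      using arg_cong[OF R, of "\<lambda>M. M $$ (a, b)"] bij_betwE[OF f] by (simp add: reindex_mat_def)
  qed (use A in auto)
next
  assume "A = 0\<^sub>m n n"
  moreover have "f a < n" if "a < n" for a using f that unfolding bij_betw_def by auto
  ultimately show "reindex_mat n f A = 0\<^sub>m n n"
    by (intro eq_matI) (auto simp: reindex_mat_def)
qed

lemma nilpotent_reindex_mat_iff:
  fixes A :: "'a :: field mat"
  assumes f: "bij_betw f {..<n} {..<n}" and A: "A \<in> carrier_mat n n"
  shows "nilpotent_mat (reindex_mat n f A) \<longleftrightarrow> nilpotent_mat A"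
proof -
  have "reindex_mat n f A ^\<^sub>m k = 0\<^sub>m n n \<longleftrightarrow> A ^\<^sub>m k = 0\<^sub>m n n" for k
    using reindex_mat_eq_0_iff[OF f pow_carrier_mat[OF A]] reindex_mat_pow[OF f A] by simp
  then show ?thesis using A by (simp add: nilpotent_mat_def reindex_mat_def)
qed

section \<open>The labelled basis and the Jordan matrix\<close>

locale jordan_partition =
  fixes mu :: "nat list" and q :: "nat \<Rightarrow> nat" and u n :: nat
  assumes partition: "is_partition mu n"
    and distinct_parts: "distinct_part_indices mu q u"
begin

text \<open>The \<open>i\<close>-th largest of the distinct parts, for \<open>i\<close> from 1 to \<open>u\<close>.\<close>

abbreviation part :: "nat \<Rightarrow> nat" where "part i \<equiv> mu_part mu (q i)"

lemma sum_list_mu [simp]: "sum_list mu = n"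
  using partition by (simp add: is_partition_def)

lemma q_mono: "i \<le> i' \<Longrightarrow> i' \<le> u \<Longrightarrow> q i \<le> q i'"
proof (induction i' rule: dec_induct)
  case (step k)
  then have "q k < q (Suc k)" using distinct_parts by (simp add: distinct_part_indices_def)
  then show ?case using step by simp
qed simp

lemma part_of_block:
  assumes "i \<in> {1..u}" "q (i - 1) \<le> b" "b < q i"
  shows "b < length mu \<and> mu ! b = part i"
proof
  have "q i \<le> length mu"
    using q_mono[of i u] assms(1) distinct_parts by (simp add: distinct_part_indices_def)
  then show "b < length mu" using assms by simp
  have "\<forall>h. q (i - 1) < h \<and> h \<le> q i \<longrightarrow> mu_part mu h = part i"
    using distinct_parts assms(1) unfolding distinct_part_indices_def by blast
  from this[rule_format, of "Suc b"] show "mu ! b = part i"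
    using assms by (simp add: mu_part_def)
qed

lemma part_strict_decreasing:
  assumes "1 \<le> i" "i < i'" "i' \<le> u"
  shows "part i' < part i"
proof -
  have step: "part (Suc k) < part k" if "1 \<le> k" "k < u" for k
    using distinct_parts that by (simp add: distinct_part_indices_def)
  have "Suc i \<le> i' \<Longrightarrow> i' \<le> u \<Longrightarrow> part i' < part i" for i'
  proof (induction i' rule: dec_induct)
    case base
    then show ?case using step[of i] assms(1) by simp
  next
    case (step k)
    then show ?case using \<open>\<And>k. 1 \<le> k \<Longrightarrow> k < u \<Longrightarrow> part (Suc k) < part k\<close>[of k] by simp
  qed
  then show ?thesis using assms by simp
qed

lemma mem_Delta:
  "(i, j, l) \<in> Delta mu q u \<longleftrightarrow>
     1 \<le> i \<and> i \<le> u \<and> 1 \<le> j \<and> j \<le> q i - q (i - 1) \<and> 1 \<le> l \<and> l \<le> part i"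
  by (auto simp: Delta_def)

lemma position_eq:
  assumes "(i, j, l) \<in> Delta mu q u"
  shows "position mu q (i, j, l) = sum_list (take (q i - j) mu) + (part i - l)"
  using assms by (simp add: block_start_def)

lemma Delta_block:
  assumes "(i, j, l) \<in> Delta mu q u"
  shows "q (i - 1) \<le> q i - j" "q i - j < q i" "q i - j < length mu" "mu ! (q i - j) = part i"
    "part i - l < mu ! (q i - j)"
proof -
  have "q (i - 1) \<le> q i" using q_mono[of "i - 1" i] assms by (simp add: mem_Delta)
  then show 1: "q (i - 1) \<le> q i - j" "q i - j < q i" using assms by (auto simp: mem_Delta)
  then show 2: "q i - j < length mu" "mu ! (q i - j) = part i"
    using part_of_block[of i "q i - j"] assms by (auto simp: mem_Delta)
  show "part i - l < mu ! (q i - j)" unfolding 2 using assms by (auto simp: mem_Delta)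
qed

lemma block_label_inj:
  assumes "(i, j, l) \<in> Delta mu q u" "(i', j', l') \<in> Delta mu q u" "q i - j = q i' - j'"
  shows "i = i' \<and> j = j'"
proof -
  note b = Delta_block[OF assms(1)] Delta_block[OF assms(2)]
  have "\<not> i < i'"
  proof
    assume "i < i'"
    then have "q i \<le> q (i' - 1)" using q_mono[of i "i' - 1"] assms by (auto simp: mem_Delta)
    then show False using b assms(3) by simp
  qed
  moreover have "\<not> i' < i"
  proof
    assume "i' < i"
    then have "q i' \<le> q (i - 1)" using q_mono[of i' "i - 1"] assms by (auto simp: mem_Delta)
    then show False using b assms(3) by simp
  qed
  ultimately have "i = i'" by simp
  then show ?thesis using assms by (auto simp: mem_Delta)
qed

lemma position_less: "x \<in> Delta mu q u \<Longrightarrow> position mu q x < n"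
proof (cases x rule: prod_cases3)
  case (fields i j l)
  assume "x \<in> Delta mu q u"
  then have x: "(i, j, l) \<in> Delta mu q u" by (simp add: fields)
  show ?thesis
    using block_offset_less[OF Delta_block(3,5)[OF x]] unfolding fields position_eq[OF x] by simp
qed

lemma inj_on_position: "inj_on (position mu q) (Delta mu q u)"
proof (rule inj_onI)
  fix x y assume x: "x \<in> Delta mu q u" and y: "y \<in> Delta mu q u"
    and eq: "position mu q x = position mu q y"
  obtain i j l i' j' l' where xy: "x = (i, j, l)" "y = (i', j', l')" by (metis prod_cases3)
  note x' = x[unfolded xy] and y' = y[unfolded xy]
  have "q i - j = q i' - j' \<and> part i - l = part i' - l'"
    using eq block_offset_inj[OF Delta_block(3,5)[OF x'] Delta_block(3,5)[OF y']]
    unfolding xy position_eq[OF x'] position_eq[OF y'] by simp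
  moreover from this have "i = i' \<and> j = j'" using block_label_inj[OF x' y'] by simp
  ultimately show "x = y" using x' y' unfolding xy by (auto simp: mem_Delta)
qed

lemma position_surj:
  assumes "r < n"
  shows "\<exists>x\<in>Delta mu q u. position mu q x = r"
proof -
  obtain b p where b: "b < length mu" "p < mu ! b" "r = sum_list (take b mu) + p"
    using block_offset_surj[of r mu] assms by auto
  have qu: "q u = length mu" "q 0 = 0" using distinct_parts by (simp_all add: distinct_part_indices_def)
  \<comment> \<open>The block \<open>b\<close> belongs to the group of equal parts ending at the first \<open>q i\<close> beyond \<open>b\<close>.\<close>
  define i where "i = (LEAST i. b < q i)"
  have bi: "b < q i" unfolding i_def by (rule LeastI[of _ u]) (simp add: qu b)
  have iu: "i \<le> u" unfolding i_def by (rule Least_le) (simp add: qu b)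
  have "i \<noteq> 0" using bi qu by (cases "i = 0") simp_all
  then have bi': "q (i - 1) \<le> b"
    using not_less_Least[of "i - 1" "\<lambda>i. b < q i"] unfolding i_def[symmetric] by simp
  have m: "mu ! b = part i" using part_of_block[of i b] iu \<open>i \<noteq> 0\<close> bi bi' by simp
  have x: "(i, q i - b, part i - p) \<in> Delta mu q u"
    using iu \<open>i \<noteq> 0\<close> bi bi' b m by (auto simp: mem_Delta)
  moreover have "position mu q (i, q i - b, part i - p) = r"
    unfolding position_eq[OF x] using b m bi by simp
  ultimately show ?thesis by blast
qed

lemma bij_betw_position: "bij_betw (position mu q) (Delta mu q u) {..<n}"
proof (rule bij_betw_imageI[OF inj_on_position], rule subset_antisym)
  show "position mu q ` Delta mu q u \<subseteq> {..<n}" using position_less by blast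
  show "{..<n} \<subseteq> position mu q ` Delta mu q u" using position_surj by blast
qed

lemma entry_eq:
  assumes "A \<in> carrier_mat n n" "x \<in> Delta mu q u" "y \<in> Delta mu q u"
  shows "entry mu q A x y = A $$ (position mu q x, position mu q y)"
  using assms position_less[of x] position_less[of y]
  by (simp add: entry_def coord_def basis_vec_def)

lemma entry_mult:
  assumes A: "A \<in> carrier_mat n n" and B: "B \<in> carrier_mat n n"
    and x: "x \<in> Delta mu q u" and y: "y \<in> Delta mu q u"
  shows "entry mu q (A * B) x y = (\<Sum>z\<in>Delta mu q u. entry mu q A x z * entry mu q B z y)"
proof -
  have "entry mu q (A * B) x y = (\<Sum>r\<in>{..<n}. A $$ (position mu q x, r) * B $$ (r, position mu q y))"
    using A B position_less[OF x] position_less[OF y]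
    by (simp add: entry_eq[OF mult_carrier_mat[OF A B] x y] scalar_prod_def atLeast0LessThan)
  also have "\<dots> = (\<Sum>z\<in>Delta mu q u. A $$ (position mu q x, position mu q z) *
      B $$ (position mu q z, position mu q y))"
    by (rule sum.reindex_bij_betw[OF bij_betw_position, symmetric])
  also have "\<dots> = (\<Sum>z\<in>Delta mu q u. entry mu q A x z * entry mu q B z y)"
    by (rule sum.cong) (simp_all add: entry_eq[OF A x] entry_eq[OF B _ y])
  finally show ?thesis .
qed

lemma mat_eq_iff_entry:
  assumes "A \<in> carrier_mat n n" "B \<in> carrier_mat n n"
  shows "A = B \<longleftrightarrow> (\<forall>x\<in>Delta mu q u. \<forall>y\<in>Delta mu q u. entry mu q A x y = entry mu q B x y)"
proof
  assume R: "\<forall>x\<in>Delta mu q u. \<forall>y\<in>Delta mu q u. entry mu q A x y = entry mu q B x y"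
  show "A = B"
  proof (rule eq_matI)
    fix r s assume "r < dim_row B" "s < dim_col B"
    then have "r < n" "s < n" using assms by simp_all
    then obtain x y where "x \<in> Delta mu q u" "y \<in> Delta mu q u" "position mu q x = r" "position mu q y = s"
      using position_surj by blast
    then show "A $$ (r, s) = B $$ (r, s)" using R entry_eq assms by metis
  qed (use assms in auto)
qed simp

lemma J_mat_carrier_n: "J_mat mu \<in> carrier_mat n n"
  using J_mat_carrier[of mu] by simp

lemma entry_J_mat:
  assumes x: "(i, j, l) \<in> Delta mu q u" and y: "(i', j', l') \<in> Delta mu q u"
  shows "entry mu q (J_mat mu :: 'a :: field mat) (i, j, l) (i', j', l') =
    (if i = i' \<and> j = j' \<and> l = Suc l' then 1 else 0)"
proof -
  have "q i - j = q i' - j' \<and> part i' - l' = Suc (part i - l) \<longleftrightarrow> i = i' \<and> j = j' \<and> l = Suc l'"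
  proof
    assume *: "q i - j = q i' - j' \<and> part i' - l' = Suc (part i - l)"
    then have "i = i' \<and> j = j'" using block_label_inj[OF x y] by simp
    then show "i = i' \<and> j = j' \<and> l = Suc l'" using * x y by (auto simp: mem_Delta)
  qed (use x y in \<open>auto simp: mem_Delta\<close>)
  then show ?thesis
    unfolding entry_eq[OF J_mat_carrier_n x y] position_eq[OF x] position_eq[OF y]
      J_mat_entry[OF Delta_block(3,5)[OF x] Delta_block(3,5)[OF y]] by simp
qed

lemma entry_mult_J_mat:
  fixes A :: "'a :: field mat"
  assumes A: "A \<in> carrier_mat n n"
    and x: "x \<in> Delta mu q u" and y: "(i, j, l) \<in> Delta mu q u"
  shows "entry mu q (A * J_mat mu) x (i, j, l) = (if l < part i then entry mu q A x (i, j, Suc l) else 0)"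
proof -
  have "entry mu q (A * J_mat mu) x (i, j, l) =
      (\<Sum>z\<in>Delta mu q u. if z = (i, j, Suc l) then entry mu q A x z else 0)"
    unfolding entry_mult[OF A J_mat_carrier_n x y]
    by (rule sum.cong[OF refl]) (use entry_J_mat[OF _ y, where 'a = 'a] in \<open>auto split: if_splits\<close>)
  also have "\<dots> = (if l < part i then entry mu q A x (i, j, Suc l) else 0)"
    using y by (simp add: finite_Delta mem_Delta Suc_le_eq)
  finally show ?thesis .
qed

lemma entry_J_mat_mult:
  fixes A :: "'a :: field mat"
  assumes A: "A \<in> carrier_mat n n"
    and x: "(i, j, l) \<in> Delta mu q u" and y: "y \<in> Delta mu q u"
  shows "entry mu q (J_mat mu * A) (i, j, l) y = (if 1 < l then entry mu q A (i, j, l - 1) y else 0)"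
proof -
  have "entry mu q (J_mat mu * A) (i, j, l) y =
      (\<Sum>z\<in>Delta mu q u. if z = (i, j, l - 1) then entry mu q A z y else 0)"
    unfolding entry_mult[OF J_mat_carrier_n A x y]
  proof (rule sum.cong[OF refl])
    fix z assume z: "z \<in> Delta mu q u"
    obtain a b c where abc: "z = (a, b, c)" by (metis prod_cases3)
    have "(i = a \<and> j = b \<and> l = Suc c) \<longleftrightarrow> z = (i, j, l - 1)"
      using z x unfolding abc by (auto simp: mem_Delta)
    then show "entry mu q (J_mat mu) (i, j, l) z * entry mu q A z y =
        (if z = (i, j, l - 1) then entry mu q A z y else 0)"
      using entry_J_mat[OF x z[unfolded abc], where 'a = 'a] unfolding abc by simp
  qed
  also have "\<dots> = (if 1 < l then entry mu q A (i, j, l - 1) y else 0)"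
    using x by (auto simp add: finite_Delta mem_Delta)
  finally show ?thesis .
qed

section \<open>Matrices commuting with the Jordan matrix\<close>

text \<open>Commutation with \<open>J_mat mu\<close> in terms of entries. The first condition says that an entry does not
  change when the exponents \<open>l\<close> and \<open>l'\<close> are raised together. The other two are the boundary cases,
  where one of the two neighbouring labels falls outside its block.\<close>

lemma commutes_J_mat_iff:
  fixes A :: "'a :: field mat"
  assumes A: "A \<in> carrier_mat n n"
  shows "A * J_mat mu = J_mat mu * A \<longleftrightarrow>
    (\<forall>i j l i' j' l'. (i, j, l) \<in> Delta mu q u \<and> (i', j', l') \<in> Delta mu q u \<longrightarrow>
      (l < part i \<and> l' < part i' \<longrightarrow>
         entry mu q A (i, j, Suc l) (i', j', Suc l') = entry mu q A (i, j, l) (i', j', l')) \<and>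
      (l = 1 \<and> 1 < l' \<longrightarrow> entry mu q A (i, j, l) (i', j', l') = 0) \<and>
      (l < part i \<and> l' = part i' \<longrightarrow> entry mu q A (i, j, l) (i', j', l') = 0))"
    (is "_ \<longleftrightarrow> ?R")
proof -
  let ?D = "Delta mu q u"
  have "A * J_mat mu = J_mat mu * A \<longleftrightarrow>
    (\<forall>x\<in>?D. \<forall>y\<in>?D. entry mu q (A * J_mat mu) x y = entry mu q (J_mat mu * A) x y)"
    by (rule mat_eq_iff_entry) (use A J_mat_carrier_n in auto)
  also have "\<dots> \<longleftrightarrow> (\<forall>i j l i' j' l'. (i, j, l) \<in> ?D \<and> (i', j', l') \<in> ?D \<longrightarrow>
      (if l' < part i' then entry mu q A (i, j, l) (i', j', Suc l') else 0) =
      (if 1 < l then entry mu q A (i, j, l - 1) (i', j', l') else 0))"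
    (is "_ \<longleftrightarrow> ?C")
    using entry_mult_J_mat[OF A] entry_J_mat_mult[OF A] by force
  also have "\<dots> \<longleftrightarrow> ?R"
  proof
    assume C: ?C
    show ?R
    proof (intro allI impI conjI; (elim conjE)?)
      fix i j l i' j' l'
      assume D: "(i, j, l) \<in> ?D" "(i', j', l') \<in> ?D"
      show "entry mu q A (i, j, Suc l) (i', j', Suc l') = entry mu q A (i, j, l) (i', j', l')"
        if "l < part i" "l' < part i'"
        using C[rule_format, of i j "Suc l" i' j' l'] D that by (simp add: mem_Delta)
      show "entry mu q A (i, j, l) (i', j', l') = 0" if "l = 1" "1 < l'"
      proof -
        obtain k where "l' = Suc k" "1 \<le> k" using \<open>1 < l'\<close> less_imp_Suc_add[of 1 l'] by auto
        then show ?thesis using C[rule_format, of i j l i' j' k] D that by (simp add: mem_Delta)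
      qed
      show "entry mu q A (i, j, l) (i', j', l') = 0" if "l < part i" "l' = part i'"
        using C[rule_format, of i j "Suc l" i' j' l'] D that by (simp add: mem_Delta)
    qed
  next
    assume R: ?R
    show ?C
    proof (intro allI impI, elim conjE)
      fix i j l i' j' l'
      assume D: "(i, j, l) \<in> ?D" "(i', j', l') \<in> ?D"
      have D1: "(i, j, l - 1) \<in> ?D" if "1 < l" using D that by (auto simp: mem_Delta)
      have D2: "(i', j', Suc l') \<in> ?D" if "l' < part i'" using D that by (auto simp: mem_Delta)
      have l: "1 \<le> l" "l \<le> part i" "1 \<le> l'" "l' \<le> part i'" using D by (simp_all add: mem_Delta)
      consider "1 < l" "l' < part i'" | "l = 1" "l' < part i'" | "1 < l" "l' = part i'" | "l = 1" "l' = part i'"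
        using l by linarith
      then show "(if l' < part i' then entry mu q A (i, j, l) (i', j', Suc l') else 0) =
        (if 1 < l then entry mu q A (i, j, l - 1) (i', j', l') else 0)"
      proof cases
        case 1
        then show ?thesis using R[rule_format, of i j "l - 1" i' j' l'] D D1 l by simp
      next
        case 2
        then show ?thesis using R[rule_format, of i j l i' j' "Suc l'"] D D2 l by simp
      next
        case 3
        then show ?thesis using R[rule_format, of i j "l - 1" i' j' l'] D D1 l by simp
      qed simp
    qed
  qed
  finally show ?thesis .
qed

end

section \<open>The ordered basis\<close>

lemma prec_irrefl: "\<not> prec mu q x x"
  by (cases x rule: prod_cases3) simp

lemma prec_asym: "prec mu q x y \<Longrightarrow> \<not> prec mu q y x"
  by (cases x rule: prod_cases3; cases y rule: prod_cases3) auto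

lemma prec_trans: "prec mu q x y \<Longrightarrow> prec mu q y z \<Longrightarrow> prec mu q x z"
  by (cases x rule: prod_cases3; cases y rule: prod_cases3; cases z rule: prod_cases3) auto

lemma prec_total:
  assumes "x \<in> Delta mu q u" "y \<in> Delta mu q u" "x \<noteq> y"
  shows "prec mu q x y \<or> prec mu q y x"
proof -
  obtain i j l i' j' l' where xy: "x = (i, j, l)" "y = (i', j', l')" by (metis prod_cases3)
  have "l \<le> mu_part mu (q i)" "l' \<le> mu_part mu (q i')"
    using assms unfolding xy by (simp_all add: Delta_def)
  then have "mu_part mu (q i) - l \<noteq> mu_part mu (q i') - l' \<or> i \<noteq> i' \<or> j \<noteq> j'"
    using assms(3) unfolding xy by auto
  then show ?thesis unfolding xy prec.simps by linarith
qed

lemma Delta_prec_props: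
  "set (Delta_prec mu q u) = Delta mu q u" "sorted_wrt (prec mu q) (Delta_prec mu q u)"
  using theI'[OF Delta_prec_ex1[of mu q u]] by (simp_all add: Delta_prec_def)

lemma Delta_prec_nth_prec_iff:
  assumes "a < length (Delta_prec mu q u)" "b < length (Delta_prec mu q u)"
  shows "prec mu q (Delta_prec mu q u ! a) (Delta_prec mu q u ! b) \<longleftrightarrow> a < b"
proof (cases a b rule: linorder_cases)
  case less
  then show ?thesis using sorted_wrt_nth_less[OF Delta_prec_props(2)] assms by simp
next
  case equal
  then show ?thesis by (simp add: prec_irrefl)
next
  case greater
  then have "prec mu q (Delta_prec mu q u ! b) (Delta_prec mu q u ! a)"
    using sorted_wrt_nth_less[OF Delta_prec_props(2)] assms by simp
  then show ?thesis using greater prec_asym by auto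
qed

lemma distinct_Delta_prec: "distinct (Delta_prec mu q u)"
  unfolding distinct_conv_nth
proof (intro allI impI)
  fix a b assume ab: "a < length (Delta_prec mu q u)" "b < length (Delta_prec mu q u)" "a \<noteq> b"
  show "Delta_prec mu q u ! a \<noteq> Delta_prec mu q u ! b"
  proof
    assume "Delta_prec mu q u ! a = Delta_prec mu q u ! b"
    then show False
      using Delta_prec_nth_prec_iff[of a mu q u b] Delta_prec_nth_prec_iff[of b mu q u a]
        prec_irrefl[of mu q] ab by auto
  qed
qed

lemma set_Delta_level: "set (Delta_level mu q u h) = {x \<in> Delta mu q u. level mu q x = h}"
  by (auto simp: Delta_level_def Delta_prec_props)

lemma sorted_Delta_level: "sorted_wrt (prec mu q) (Delta_level mu q u h)"
  by (simp add: Delta_level_def Delta_prec_props sorted_wrt_filter)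

lemma prec_sorted_unique:
  assumes "set xs = set ys" "set ys \<subseteq> Delta mu q u"
    and "sorted_wrt (prec mu q) xs" "sorted_wrt (prec mu q) ys"
  shows "xs = ys"
proof -
  have "\<exists>!zs. set zs = set ys \<and> sorted_wrt (prec mu q) zs"
  proof (rule sorted_wrt_list_ex1)
    show "prec mu q x y \<or> prec mu q y x" if "x \<in> set ys" "y \<in> set ys" "x \<noteq> y" for x y
      using prec_total[of x mu q u y] assms(2) that by blast
  qed (use prec_asym prec_trans in blast)+
  then show ?thesis using assms by blast
qed

text \<open>The label of \<open>J v\<close> for the basis vector \<open>v\<close> labelled \<open>(i, j, l)\<close>; it has level one less. It is a
  label of the basis only if \<open>l\<close> is smaller than \<open>mu_part mu (q i)\<close>, that is, if the level is
  positive.\<close>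

fun shift_label :: "label \<Rightarrow> label" where
  "shift_label (i, j, l) = (i, j, Suc l)"

context jordan_partition
begin

lemma length_Delta_prec: "length (Delta_prec mu q u) = n"
  using distinct_card[OF distinct_Delta_prec[of mu q u]] bij_betw_same_card[OF bij_betw_position]
  by (simp add: Delta_prec_props)

lemma Delta_prec_nth: "a < n \<Longrightarrow> Delta_prec mu q u ! a \<in> Delta mu q u"
  using nth_mem[of a "Delta_prec mu q u"] by (simp add: Delta_prec_props length_Delta_prec)

lemma Delta_prec_index:
  "x \<in> Delta mu q u \<Longrightarrow> \<exists>a<n. Delta_prec mu q u ! a = x"
  using in_set_conv_nth[of x "Delta_prec mu q u"] by (auto simp: Delta_prec_props length_Delta_prec)

lemma bij_betw_Delta_prec: "bij_betw (\<lambda>a. position mu q (Delta_prec mu q u ! a)) {..<n} {..<n}"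
proof -
  have "bij_betw ((!) (Delta_prec mu q u)) {..<n} (Delta mu q u)"
    by (rule bij_betw_nth) (simp_all add: distinct_Delta_prec Delta_prec_props length_Delta_prec)
  from bij_betw_trans[OF this bij_betw_position] show ?thesis by (simp add: o_def)
qed

lemma matrix_prec_index:
  "a < n \<Longrightarrow> b < n \<Longrightarrow>
    matrix_prec mu q u A $$ (a, b) = entry mu q A (Delta_prec mu q u ! a) (Delta_prec mu q u ! b)"
  by (simp add: matrix_prec_def Let_def length_Delta_prec)

lemma matrix_prec_dim [simp]:
  "dim_row (matrix_prec mu q u A) = n" "dim_col (matrix_prec mu q u A) = n"
  by (simp_all add: matrix_prec_def Let_def length_Delta_prec)

lemma matrix_prec_carrier: "matrix_prec mu q u A \<in> carrier_mat n n"
  by (intro carrier_matI) simp_all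

lemma matrix_prec_eq_reindex:
  assumes "A \<in> carrier_mat n n"
  shows "matrix_prec mu q u A = reindex_mat n (\<lambda>a. position mu q (Delta_prec mu q u ! a)) A"
  using assms
  by (intro eq_matI) (auto simp: matrix_prec_index reindex_mat_def entry_eq Delta_prec_nth)

lemma nilpotent_matrix_prec_iff:
  fixes A :: "'a :: field mat"
  assumes "A \<in> carrier_mat n n"
  shows "nilpotent_mat (matrix_prec mu q u A) \<longleftrightarrow> nilpotent_mat A"
  using nilpotent_reindex_mat_iff[OF bij_betw_Delta_prec assms] matrix_prec_eq_reindex[OF assms]
  by simp

lemma strictly_upper_triangular_matrix_prec_iff:
  "strictly_upper_triangular (matrix_prec mu q u A) \<longleftrightarrow>
    (\<forall>x\<in>Delta mu q u. \<forall>y\<in>Delta mu q u. \<not> prec mu q x y \<longrightarrow> entry mu q A x y = 0)"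
    (is "?S \<longleftrightarrow> ?R")
proof
  assume S: ?S
  show ?R
  proof (intro ballI impI)
    fix x y assume xy: "x \<in> Delta mu q u" "y \<in> Delta mu q u" "\<not> prec mu q x y"
    obtain a b where ab: "a < n" "b < n" "x = Delta_prec mu q u ! a" "y = Delta_prec mu q u ! b"
      using xy Delta_prec_index by metis
    then have "b \<le> a" using xy Delta_prec_nth_prec_iff[of a mu q u b] by (simp add: length_Delta_prec)
    then show "entry mu q A x y = 0"
      using S ab matrix_prec_index[of a b A] by (simp add: strictly_upper_triangular_def)
  qed
next
  assume R: ?R
  have "matrix_prec mu q u A $$ (a, b) = 0" if "a < n" "b < n" "b \<le> a" for a b
    using R that Delta_prec_nth[of a] Delta_prec_nth[of b] Delta_prec_nth_prec_iff[of a mu q u b]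
    by (simp add: matrix_prec_index length_Delta_prec)
  then show ?S by (simp add: strictly_upper_triangular_def)
qed

lemma upper_triangular_matrix_precI:
  assumes "\<And>x y. x \<in> Delta mu q u \<Longrightarrow> y \<in> Delta mu q u \<Longrightarrow> prec mu q y x \<Longrightarrow> entry mu q A x y = 0"
  shows "upper_triangular (matrix_prec mu q u A)"
proof (rule upper_triangularI)
  fix a b assume ab: "b < a" "a < dim_row (matrix_prec mu q u A)"
  then have "prec mu q (Delta_prec mu q u ! b) (Delta_prec mu q u ! a)"
    using Delta_prec_nth_prec_iff[of b mu q u a] by (simp add: length_Delta_prec)
  then show "matrix_prec mu q u A $$ (a, b) = 0"
    using ab assms Delta_prec_nth[of a] Delta_prec_nth[of b] by (simp add: matrix_prec_index)
qed

section \<open>The blocks between levels\<close>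

lemma level_block_dim [simp]:
  "dim_row (level_block mu q u A h k) = length (Delta_level mu q u h)"
  "dim_col (level_block mu q u A h k) = length (Delta_level mu q u k)"
  by (simp_all add: level_block_def Let_def)

lemma level_block_index:
  assumes "a < length (Delta_level mu q u h)" "b < length (Delta_level mu q u k)"
  shows "level_block mu q u A h k $$ (a, b) =
    entry mu q A (Delta_level mu q u h ! a) (Delta_level mu q u k ! b)"
proof -
  have mem: "Delta_level mu q u h ! a \<in> set (Delta_level mu q u h)" using assms by simp
  then have "position mu q (Delta_level mu q u h ! a) < n"
    using position_less by (simp add: set_Delta_level)
  then show ?thesis
    using assms mem by (simp add: level_block_def Let_def entry_def coord_def proj_def)
qed

text \<open>The labels of level \<open>h - 1\<close> are the shifted labels of level \<open>h\<close>, in the same order, followed by those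
  belonging to the part \<open>h\<close>, which have no predecessor. The latter come last because parts decrease
  with \<open>i\<close>. So the indices of an entry of \<open>A\<^bsub>h,k\<^esub>\<close> denote in \<open>A\<^bsub>h-1,k-1\<^esub>\<close> the entry at the shifted
  labels.\<close>

lemma Delta_level_shift:
  assumes h: "1 \<le> h"
  shows "Delta_level mu q u (h - 1) =
    map shift_label (Delta_level mu q u h) @
    filter (\<lambda>(i, j, l). part i = h) (Delta_level mu q u (h - 1))"
    (is "?X = map shift_label ?Y @ ?Z")
proof (rule prec_sorted_unique[OF _ _ sorted_Delta_level])
  show "set ?X = set (map shift_label ?Y @ ?Z)"
  proof (rule Set.set_eqI)
    fix x :: label
    obtain i j l where x: "x = (i, j, l)" by (metis prod_cases3)
    have shifted: "x \<in> shift_label ` set ?Y \<longleftrightarrow> x \<in> set ?X \<and> h < part i"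
    proof
      assume "x \<in> shift_label ` set ?Y"
      then obtain y where y: "y \<in> set ?Y" "x = shift_label y" by blast
      obtain a b c where abc: "y = (a, b, c)" by (metis prod_cases3)
      show "x \<in> set ?X \<and> h < part i"
        using y h unfolding abc x by (auto simp: set_Delta_level mem_Delta)
    next
      assume *: "x \<in> set ?X \<and> h < part i"
      then have "1 < l" "(i, j, l - 1) \<in> set ?Y"
        using h by (auto simp: x set_Delta_level mem_Delta)
      then have "x = shift_label (i, j, l - 1)" "(i, j, l - 1) \<in> set ?Y" by (simp_all add: x)
      then show "x \<in> shift_label ` set ?Y" by blast
    qed
    have "h \<le> part i" if "x \<in> set ?X"
      using that by (auto simp: x set_Delta_level mem_Delta)
    then show "x \<in> set ?X \<longleftrightarrow> x \<in> set (map shift_label ?Y @ ?Z)"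
      unfolding set_append set_map Un_iff shifted set_filter by (auto simp: x)
  qed
  then show "set (map shift_label ?Y @ ?Z) \<subseteq> Delta mu q u"
    by (auto simp: set_Delta_level)
  have "sorted_wrt (prec mu q) (map shift_label ?Y)"
    unfolding sorted_wrt_map
  proof (rule sorted_wrt_mono_rel[OF _ sorted_Delta_level])
    fix x y assume "x \<in> set ?Y" "y \<in> set ?Y" "prec mu q x y"
    then show "prec mu q (shift_label x) (shift_label y)"
      by (cases x rule: prod_cases3; cases y rule: prod_cases3) (auto simp: set_Delta_level)
  qed
  moreover have "sorted_wrt (prec mu q) ?Z" by (intro sorted_wrt_filter sorted_Delta_level)
  moreover have "prec mu q (shift_label x) z" if "x \<in> set ?Y" "z \<in> set ?Z" for x z
  proof -
    obtain i j l i' j' l' where xz: "x = (i, j, l)" "z = (i', j', l')" by (metis prod_cases3)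
    have D: "(i, j, l) \<in> Delta mu q u" "part i - l = h" "(i', j', l') \<in> Delta mu q u"
      "part i' - l' = h - 1" "part i' = h"
      using that by (auto simp: xz set_Delta_level)
    then have "part i' < part i" "1 \<le> i'" "i \<le> u" by (auto simp: mem_Delta)
    then have "i < i'" using part_strict_decreasing[of i' i] by (cases i i' rule: linorder_cases) auto
    moreover have "part i - Suc l = part i' - l'" using D by simp
    ultimately show ?thesis unfolding xz by simp
  qed
  ultimately show "sorted_wrt (prec mu q) (map shift_label ?Y @ ?Z)"
    by (auto simp: sorted_wrt_append)
qed

lemma Delta_level_shift_nth:
  assumes "1 \<le> h" "a < length (Delta_level mu q u h)"
  shows "a < length (Delta_level mu q u (h - 1))"
    "Delta_level mu q u (h - 1) ! a = shift_label (Delta_level mu q u h ! a)"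
proof -
  show "a < length (Delta_level mu q u (h - 1))"
    using assms by (subst Delta_level_shift) auto
  show "Delta_level mu q u (h - 1) ! a = shift_label (Delta_level mu q u h ! a)"
    using assms by (subst Delta_level_shift) (auto simp: nth_append)
qed

text \<open>Condition ii) in terms of labels: the entries are invariant under a simultaneous shift, as far as
  the level of the row does not exceed that of the column.\<close>

lemma level_block_shift_iff:
  "(\<forall>k \<in> {1..part 1 - 1}. \<forall>h \<in> {1..k}.
     \<forall>a < dim_row (level_block mu q u A h k). \<forall>b < dim_col (level_block mu q u A h k).
       level_block mu q u A h k $$ (a, b) = level_block mu q u A (h - 1) (k - 1) $$ (a, b)) \<longleftrightarrow>
   (\<forall>i j l i' j' l'. (i, j, l) \<in> Delta mu q u \<and> (i', j', l') \<in> Delta mu q u \<and>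
     l < part i \<and> part i - l \<le> part i' - l' \<longrightarrow>
     entry mu q A (i, j, Suc l) (i', j', Suc l') = entry mu q A (i, j, l) (i', j', l'))"
    (is "?L \<longleftrightarrow> ?R")
proof
  assume L: ?L
  show ?R
  proof (intro allI impI, elim conjE)
    fix i j l i' j' l'
    assume D: "(i, j, l) \<in> Delta mu q u" "(i', j', l') \<in> Delta mu q u"
      and l: "l < part i" "part i - l \<le> part i' - l'"
    \<comment> \<open>The largest part bounds the column level, so \<open>k\<close> is within the range of condition ii).\<close>
    define h k where hk: "h = part i - l" "k = part i' - l'"
    have "part i' \<le> part 1"
      using part_strict_decreasing[of 1 i'] D by (cases "i' = 1") (auto simp: mem_Delta)
    then have k: "k \<in> {1..part 1 - 1}" "h \<in> {1..k}"
      using D l by (auto simp: hk mem_Delta)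
    have "(i, j, l) \<in> set (Delta_level mu q u h)" "(i', j', l') \<in> set (Delta_level mu q u k)"
      using D by (simp_all add: set_Delta_level hk)
    then obtain a b where a: "a < length (Delta_level mu q u h)" "Delta_level mu q u h ! a = (i, j, l)"
      and b: "b < length (Delta_level mu q u k)" "Delta_level mu q u k ! b = (i', j', l')"
      unfolding in_set_conv_nth by blast
    have "level_block mu q u A h k $$ (a, b) = level_block mu q u A (h - 1) (k - 1) $$ (a, b)"
      using L k a b by simp
    then show "entry mu q A (i, j, Suc l) (i', j', Suc l') = entry mu q A (i, j, l) (i', j', l')"
      using a b k Delta_level_shift_nth[of h a] Delta_level_shift_nth[of k b]
      by (simp add: level_block_index)
  qed
next
  assume R: ?R
  show ?L
  proof (intro ballI allI impI)
    fix k h a b assume k: "k \<in> {1..part 1 - 1}" "h \<in> {1..k}"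
      and ab: "a < dim_row (level_block mu q u A h k)" "b < dim_col (level_block mu q u A h k)"
    obtain i j l i' j' l' where x: "Delta_level mu q u h ! a = (i, j, l)"
      and y: "Delta_level mu q u k ! b = (i', j', l')" by (metis prod_cases3)
    have "(i, j, l) \<in> set (Delta_level mu q u h)" "(i', j', l') \<in> set (Delta_level mu q u k)"
      using ab nth_mem[of a "Delta_level mu q u h"] nth_mem[of b "Delta_level mu q u k"]
      by (simp_all add: x y)
    then have "entry mu q A (i, j, Suc l) (i', j', Suc l') = entry mu q A (i, j, l) (i', j', l')"
      using k by (intro R[rule_format]) (auto simp: set_Delta_level)
    then show "level_block mu q u A h k $$ (a, b) = level_block mu q u A (h - 1) (k - 1) $$ (a, b)"
      using ab k x y Delta_level_shift_nth[of h a] Delta_level_shift_nth[of k b]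
      by (simp add: level_block_index)
  qed
qed

section \<open>The diagonal matrices of equal blocks\<close>

lemma part_pos:
  assumes "1 \<le> i" "i \<le> u"
  shows "1 \<le> part i"
proof -
  have "q (i - 1) < q i"
    using distinct_parts assms by (cases i) (simp_all add: distinct_part_indices_def)
  then have "q i - 1 < length mu" "mu ! (q i - 1) = part i"
    using part_of_block[of i "q i - 1"] assms by auto
  then have "part i \<in> set mu" using nth_mem[of "q i - 1" mu] by simp
  then show ?thesis using partition by (simp add: is_partition_def)
qed

text \<open>The labels number the blocks of a given size in reverse, so the row of \<open>A(i)\<close> belonging to \<open>j\<close> is
  \<open>q i - j - q (i - 1)\<close>.\<close>

lemma diag_mat_of_index:
  fixes A :: "'a :: field mat"
  assumes A: "A \<in> carrier_mat n n"
    and x: "(i, j, part i) \<in> Delta mu q u" and y: "(i, j', part i) \<in> Delta mu q u"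
  shows "diag_mat_of mu q A i $$ (q i - j - q (i - 1), q i - j' - q (i - 1)) =
    entry mu q A (i, j, part i) (i, j', part i)"
proof -
  have part: "mu_part mu (Suc (q i - j)) = part i" "mu_part mu (Suc (q i - j')) = part i" "0 < part i"
    using Delta_block[OF x] Delta_block[OF y] x by (simp_all add: mu_part_def)
  have "q i - j - q (i - 1) < q i - q (i - 1)" "q i - j' - q (i - 1) < q i - q (i - 1)"
    using Delta_block(1,2)[OF x] Delta_block(1,2)[OF y] by linarith+
  then show ?thesis
    using part Delta_block(1)[OF x] Delta_block(1)[OF y]
    unfolding entry_eq[OF A x y] position_eq[OF x] position_eq[OF y]
    by (simp add: diag_mat_of_def blk_def block_start_def del: diff_diff_left)
qed

lemma diag_mat_of_dim [simp]:
  "dim_row (diag_mat_of mu q A i) = q i - q (i - 1)"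
  "dim_col (diag_mat_of mu q A i) = q i - q (i - 1)"
  by (simp_all add: diag_mat_of_def)

text \<open>By the reversed numbering, lower triangularity of \<open>A(i)\<close> in the order of the blocks is upper
  triangularity in the order of \<open>j\<close>.\<close>

lemma lower_triangular_diag_mat_of_iff:
  fixes A :: "'a :: field mat"
  assumes A: "A \<in> carrier_mat n n" and i: "1 \<le> i" "i \<le> u"
  shows "is_lower_triangular (diag_mat_of mu q A i) \<longleftrightarrow>
    (\<forall>j j'. (i, j, part i) \<in> Delta mu q u \<and> (i, j', part i) \<in> Delta mu q u \<and> j' < j \<longrightarrow>
      entry mu q A (i, j, part i) (i, j', part i) = 0)" (is "?L \<longleftrightarrow> ?R")
proof
  assume L: ?L
  show ?R
  proof (intro allI impI, elim conjE)
    fix j j' assume x: "(i, j, part i) \<in> Delta mu q u" and y: "(i, j', part i) \<in> Delta mu q u"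
      and j: "j' < j"
    have "q i - j - q (i - 1) < q i - j' - q (i - 1)" "q i - j' - q (i - 1) < q i - q (i - 1)"
      using Delta_block(1,2)[OF x] Delta_block(1,2)[OF y] x[unfolded mem_Delta] y[unfolded mem_Delta] j
      by linarith+
    then show "entry mu q A (i, j, part i) (i, j', part i) = 0"
      using L unfolding is_lower_triangular_def diag_mat_of_index[OF A x y, symmetric] diag_mat_of_dim
      by (meson less_trans)
  qed
next
  assume R: ?R
  show ?L
    unfolding is_lower_triangular_def
  proof (intro allI impI)
    fix a b assume ab: "a < dim_row (diag_mat_of mu q A i)" "b < dim_col (diag_mat_of mu q A i)" "a < b"
    define j j' where j: "j = q i - q (i - 1) - a" "j' = q i - q (i - 1) - b"
    have ab': "b < q i - q (i - 1)" using ab by simp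
    have x: "(i, j, part i) \<in> Delta mu q u" and y: "(i, j', part i) \<in> Delta mu q u"
      using i part_pos[OF i] ab ab' by (auto simp: mem_Delta j)
    have "q i - j - q (i - 1) = a" "q i - j' - q (i - 1) = b" "j' < j"
      using ab ab' by (simp_all add: j)
    then show "diag_mat_of mu q A i $$ (a, b) = 0"
      using diag_mat_of_index[OF A x y] R x y by simp
  qed
qed

section \<open>Entrywise description of the nilpotent matrices\<close>

text \<open>The linear conditions of the statement on the entries of a matrix: strict upper triangularity with
  respect to \<open>prec\<close>, vanishing in case i), and condition ii) in its form in terms of labels.\<close>

definition sn_conditions :: "'a :: field mat \<Rightarrow> bool" where
  "sn_conditions A \<longleftrightarrow>
     (\<forall>x\<in>Delta mu q u. \<forall>y\<in>Delta mu q u. \<not> prec mu q x y \<longrightarrow> entry mu q A x y = 0) \<and>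
     (\<forall>i j l i' j' l'. (i, j, l) \<in> Delta mu q u \<and> (i', j', l') \<in> Delta mu q u \<and>
        int (part i') - int (part i) > int l' - int l \<and> int l' - int l > 0 \<longrightarrow>
        entry mu q A (i, j, l) (i', j', l') = 0) \<and>
     (\<forall>i j l i' j' l'. (i, j, l) \<in> Delta mu q u \<and> (i', j', l') \<in> Delta mu q u \<and>
        l < part i \<and> part i - l \<le> part i' - l' \<longrightarrow>
        entry mu q A (i, j, Suc l) (i', j', Suc l') = entry mu q A (i, j, l) (i', j', l'))"

text \<open>For \<open>l < l'\<close> the entry is moved by the shift invariance down to row exponent 1 with column exponent
  greater than 1; for a row level above the column level it is moved up to column level 0 with positive
  row level. It vanishes there by the boundary conditions.\<close>

lemma commuting_entry_eq_0:
  fixes A :: "'a :: field mat"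
  assumes A: "A \<in> carrier_mat n n" and comm: "A * J_mat mu = J_mat mu * A"
    and x: "(i, j, l) \<in> Delta mu q u" and y: "(i', j', l') \<in> Delta mu q u"
    and off: "l < l' \<or> part i' - l' < part i - l"
  shows "entry mu q A (i, j, l) (i', j', l') = 0"
proof -
  note C = comm[unfolded commutes_J_mat_iff[OF A], rule_format]
  have down: "entry mu q A (i, j, l) (i', j', l') = 0"
    if "(i, j, l) \<in> Delta mu q u" "(i', j', l') \<in> Delta mu q u" "l < l'" for l l'
    using that
  proof (induction l arbitrary: l')
    case 0
    then show ?case by (simp add: mem_Delta)
  next
    case (Suc l)
    obtain k where k: "l' = Suc k" using Suc.prems by (cases l') auto
    show ?case
    proof (cases "l = 0")
      case True
      then show ?thesis using C[of i j "Suc l" i' j' l'] Suc.prems by auto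
    next
      case False
      then have D: "(i, j, l) \<in> Delta mu q u" "(i', j', k) \<in> Delta mu q u"
        using Suc.prems k by (auto simp: mem_Delta)
      have "l < part i" "k < part i'" using Suc.prems k by (auto simp: mem_Delta)
      then show ?thesis using C[of i j l i' j' k] Suc.IH[of k] Suc.prems D k by simp
    qed
  qed
  have up: "entry mu q A (i, j, l) (i', j', l') = 0"
    if "(i, j, l) \<in> Delta mu q u" "(i', j', l') \<in> Delta mu q u" "part i' - l' < part i - l" for l l'
    using that
  proof (induction "part i' - l'" arbitrary: l l')
    case 0
    then have "l' = part i'" "l < part i" by (auto simp: mem_Delta)
    then show ?case using C[of i j l i' j' l'] 0 by simp
  next
    case (Suc k)
    then have D: "(i, j, Suc l) \<in> Delta mu q u" "(i', j', Suc l') \<in> Delta mu q u"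
      by (auto simp: mem_Delta)
    have "l < part i" "l' < part i'" using Suc by auto
    then show ?case
      using C[of i j l i' j' l'] Suc.hyps(1)[of "Suc l'" "Suc l"] Suc.hyps(2) Suc.prems D by simp
  qed
  show ?thesis using off down[OF x y] up[OF x y] by blast
qed

lemma commuting_entry_diag:
  fixes A :: "'a :: field mat"
  assumes A: "A \<in> carrier_mat n n" and comm: "A * J_mat mu = J_mat mu * A"
    and x: "(i, j, l) \<in> Delta mu q u" and y: "(i, j', l) \<in> Delta mu q u"
  shows "entry mu q A (i, j, l) (i, j', l) = entry mu q A (i, j, part i) (i, j', part i)"
  using x y
proof (induction "part i - l" arbitrary: l)
  case 0
  then show ?case by (simp add: mem_Delta)
next
  case (Suc k)
  then have D: "(i, j, Suc l) \<in> Delta mu q u" "(i, j', Suc l) \<in> Delta mu q u"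
    by (auto simp: mem_Delta)
  have "l < part i" using Suc by auto
  then show ?case
    using comm[unfolded commutes_J_mat_iff[OF A], rule_format, of i j l i j' l]
      Suc.hyps(1)[of "Suc l"] Suc.hyps(2) Suc.prems D by simp
qed

text \<open>Only entries between labels of the same level and the same part can still be non-zero below the
  diagonal; these are entries of \<open>A(i)\<close>. Nilpotency then removes the diagonal.\<close>

lemma SN_imp_sn_conditions:
  fixes A :: "'a :: field mat"
  assumes A: "A \<in> carrier_mat n n" and comm: "A * J_mat mu = J_mat mu * A"
    and nil: "nilpotent_mat A"
    and lower: "\<forall>i\<in>{1..u}. is_lower_triangular (diag_mat_of mu q A i)"
  shows "sn_conditions A"
proof -
  have "upper_triangular (matrix_prec mu q u A)"
  proof (rule upper_triangular_matrix_precI)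
    fix x y assume xy: "x \<in> Delta mu q u" "y \<in> Delta mu q u" "prec mu q y x"
    obtain i j l i' j' l' where x: "x = (i, j, l)" and y: "y = (i', j', l')" by (metis prod_cases3)
    have D: "(i, j, l) \<in> Delta mu q u" "(i', j', l') \<in> Delta mu q u" using xy x y by simp_all
    then have b: "1 \<le> i'" "i \<le> u" "1 \<le> i" "l \<le> part i" "l' \<le> part i'" by (simp_all add: mem_Delta)
    from xy(3) consider "part i' - l' < part i - l"
      | "part i' - l' = part i - l" "i' < i" | "part i' - l' = part i - l" "i' = i" "j' < j"
      unfolding x y by auto
    then show "entry mu q A x y = 0"
    proof cases
      case 1
      then show ?thesis using commuting_entry_eq_0[OF A comm D] x y by simp
    next
      \<comment> \<open>Equal levels and a larger part for the column force a larger column exponent.\<close>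
      case 2
      then have "l < l'" using part_strict_decreasing[of i' i] b by simp
      then show ?thesis using commuting_entry_eq_0[OF A comm D] x y by simp
    next
      case 3
      then have l: "l' = l" using b by simp
      have "(i, j, part i) \<in> Delta mu q u" "(i, j', part i) \<in> Delta mu q u"
        using D 3 by (auto simp: mem_Delta)
      then have "entry mu q A (i, j, part i) (i, j', part i) = 0"
        using lower lower_triangular_diag_mat_of_iff[OF A, of i] b 3 by simp
      then show ?thesis
        using commuting_entry_diag[OF A comm, of i j l j'] D 3 l x y by simp
    qed
  qed
  then have "strictly_upper_triangular (matrix_prec mu q u A)"
    using nilpotent_upper_triangular_iff[OF matrix_prec_carrier, of A] nilpotent_matrix_prec_iff[OF A] nil
    by simp
  then have "\<forall>x\<in>Delta mu q u. \<forall>y\<in>Delta mu q u. \<not> prec mu q x y \<longrightarrow> entry mu q A x y = 0"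
    by (simp only: strictly_upper_triangular_matrix_prec_iff)
  moreover have "entry mu q A (i, j, l) (i', j', l') = 0"
    if "(i, j, l) \<in> Delta mu q u" "(i', j', l') \<in> Delta mu q u" "int l' - int l > 0" for i j l i' j' l'
    using commuting_entry_eq_0[OF A comm that(1,2)] that(3) by simp
  moreover have "entry mu q A (i, j, Suc l) (i', j', Suc l') = entry mu q A (i, j, l) (i', j', l')"
    if "(i, j, l) \<in> Delta mu q u" "(i', j', l') \<in> Delta mu q u"
      "l < part i" "part i - l \<le> part i' - l'" for i j l i' j' l'
    using comm[unfolded commutes_J_mat_iff[OF A], rule_format, of i j l i' j' l'] that by simp
  ultimately show ?thesis unfolding sn_conditions_def by blast
qed

lemma sn_conditions_imp_SN:
  fixes A :: "'a :: field mat"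
  assumes A: "A \<in> carrier_mat n n" and sn: "sn_conditions A"
  shows "nilpotent_mat A" "A * J_mat mu = J_mat mu * A"
    "\<forall>i\<in>{1..u}. is_lower_triangular (diag_mat_of mu q A i)"
proof -
  have strict: "entry mu q A x y = 0"
    if "x \<in> Delta mu q u" "y \<in> Delta mu q u" "\<not> prec mu q x y" for x y
    using sn that unfolding sn_conditions_def by blast
  have gap: "entry mu q A (i, j, l) (i', j', l') = 0"
    if "(i, j, l) \<in> Delta mu q u" "(i', j', l') \<in> Delta mu q u"
      "int (part i') - int (part i) > int l' - int l" "int l' - int l > 0" for i j l i' j' l'
    using sn that unfolding sn_conditions_def by blast
  have shift: "entry mu q A (i, j, Suc l) (i', j', Suc l') = entry mu q A (i, j, l) (i', j', l')"
    if "(i, j, l) \<in> Delta mu q u" "(i', j', l') \<in> Delta mu q u"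
      "l < part i" "part i - l \<le> part i' - l'" for i j l i' j' l'
    using sn that unfolding sn_conditions_def by blast
  have str: "strictly_upper_triangular (matrix_prec mu q u A)"
    unfolding strictly_upper_triangular_matrix_prec_iff using strict by blast
  then have "upper_triangular (matrix_prec mu q u A)"
    by (intro upper_triangularI) (simp add: strictly_upper_triangular_def)
  then show "nilpotent_mat A"
    using nilpotent_upper_triangular_iff[OF matrix_prec_carrier, of A] nilpotent_matrix_prec_iff[OF A] str
    by simp
  show "A * J_mat mu = J_mat mu * A"
    unfolding commutes_J_mat_iff[OF A]
  proof (intro allI impI conjI; elim conjE)
    fix i j l i' j' l'
    assume D: "(i, j, l) \<in> Delta mu q u" "(i', j', l') \<in> Delta mu q u"
    then have b: "1 \<le> i" "i \<le> u" "1 \<le> i'" "i' \<le> u" "1 \<le> l" "l \<le> part i" "1 \<le> l'" "l' \<le> part i'"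
      by (simp_all add: mem_Delta)
    show "entry mu q A (i, j, Suc l) (i', j', Suc l') = entry mu q A (i, j, l) (i', j', l')"
      if l: "l < part i" "l' < part i'"
    proof (cases "part i - l \<le> part i' - l'")
      case True
      then show ?thesis using shift[OF D] l by simp
    next
      case False
      have "(i, j, Suc l) \<in> Delta mu q u" "(i', j', Suc l') \<in> Delta mu q u"
        using D l by (auto simp: mem_Delta)
      then have "entry mu q A (i, j, Suc l) (i', j', Suc l') = 0"
        using False l by (intro strict) auto
      moreover have "entry mu q A (i, j, l) (i', j', l') = 0"
        using False by (intro strict D) auto
      ultimately show ?thesis by simp
    qed
    \<comment> \<open>When \<open>(i, j, 1)\<close> precedes \<open>(i', j', l')\<close> with \<open>l' > 1\<close>, only a
      difference of levels is possible, and then condition i) applies.\<close>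
    show "entry mu q A (i, j, l) (i', j', l') = 0" if l: "l = 1" "1 < l'"
    proof (cases "prec mu q (i, j, l) (i', j', l')")
      case False
      then show ?thesis by (intro strict D)
    next
      case True
      then consider "part i - l < part i' - l'" | "part i - l = part i' - l'" "i < i'"
        | "part i - l = part i' - l'" "i = i'"
        by auto
      then show ?thesis
      proof cases
        case 1
        then show ?thesis using b l by (intro gap D) auto
      next
        case 2
        then have "part i' < part i" using part_strict_decreasing b by simp
        then show ?thesis using 2 b l by simp
      next
        case 3
        then show ?thesis using b l by simp
      qed
    qed
    show "entry mu q A (i, j, l) (i', j', l') = 0" if "l < part i" "l' = part i'"
      using that by (intro strict D) auto
  qed
  show "\<forall>i\<in>{1..u}. is_lower_triangular (diag_mat_of mu q A i)"
  proof
    fix i assume "i \<in> {1..u}"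
    then have i: "1 \<le> i" "i \<le> u" by simp_all
    show "is_lower_triangular (diag_mat_of mu q A i)"
      unfolding lower_triangular_diag_mat_of_iff[OF A i] using strict by auto
  qed
qed

lemma SN_eq: "(SN mu q u :: 'a :: field mat set) = {A \<in> carrier_mat n n. sn_conditions A}"
  using SN_imp_sn_conditions sn_conditions_imp_SN unfolding SN_def sum_list_mu by blast

section \<open>The linear structure\<close>

lemma matrix_prec_add:
  assumes "A \<in> carrier_mat n n" "B \<in> carrier_mat n n"
  shows "matrix_prec mu q u A + matrix_prec mu q u B = matrix_prec mu q u (A + B)"
  using assms position_less[OF Delta_prec_nth]
  by (intro eq_matI) (auto simp: matrix_prec_index Delta_prec_nth entry_eq)

lemma matrix_prec_smult:
  assumes "A \<in> carrier_mat n n"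
  shows "c \<cdot>\<^sub>m matrix_prec mu q u A = matrix_prec mu q u (c \<cdot>\<^sub>m A)"
  using assms position_less[OF Delta_prec_nth]
  by (intro eq_matI) (auto simp: matrix_prec_index Delta_prec_nth entry_eq)

lemma matrix_prec_zero: "matrix_prec mu q u (0\<^sub>m n n :: 'a :: field mat) = 0\<^sub>m n n"
  using position_less[OF Delta_prec_nth]
  by (intro eq_matI) (auto simp: matrix_prec_index Delta_prec_nth entry_eq)

lemma sn_conditions_zero: "sn_conditions (0\<^sub>m n n :: 'a :: field mat)"
proof -
  have e: "entry mu q (0\<^sub>m n n :: 'a mat) x y = 0" if "x \<in> Delta mu q u" "y \<in> Delta mu q u" for x y
    using that position_less by (simp add: entry_eq)
  show ?thesis
    unfolding sn_conditions_def
  proof (intro conjI ballI allI impI; (elim conjE)?)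
    fix i j l i' j' l'
    assume D: "(i, j, l) \<in> Delta mu q u" "(i', j', l') \<in> Delta mu q u"
      and l: "l < part i" "part i - l \<le> part i' - l'"
    then have "(i, j, Suc l) \<in> Delta mu q u" "(i', j', Suc l') \<in> Delta mu q u"
      by (auto simp: mem_Delta)
    then show "entry mu q (0\<^sub>m n n :: 'a mat) (i, j, Suc l) (i', j', Suc l') =
        entry mu q (0\<^sub>m n n :: 'a mat) (i, j, l) (i', j', l')"
      using D l by (simp add: e)
  qed (use e in \<open>auto simp: e sn_conditions_def\<close>)
qed

lemma sn_conditions_linear:
  fixes A B :: "'a :: field mat"
  assumes A: "A \<in> carrier_mat n n" "sn_conditions A" and B: "B \<in> carrier_mat n n" "sn_conditions B"
  shows "sn_conditions (c \<cdot>\<^sub>m A + B)"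
proof -
  have e: "entry mu q (c \<cdot>\<^sub>m A + B) x y = c * entry mu q A x y + entry mu q B x y"
    if "x \<in> Delta mu q u" "y \<in> Delta mu q u" for x y
    using that A B position_less[OF that(1)] position_less[OF that(2)] by (simp add: entry_eq)
  show ?thesis
    unfolding sn_conditions_def
  proof (intro conjI ballI allI impI; (elim conjE)?)
    fix i j l i' j' l'
    assume D: "(i, j, l) \<in> Delta mu q u" "(i', j', l') \<in> Delta mu q u"
      and l: "l < part i" "part i - l \<le> part i' - l'"
    then have "(i, j, Suc l) \<in> Delta mu q u" "(i', j', Suc l') \<in> Delta mu q u"
      by (auto simp: mem_Delta)
    then show "entry mu q (c \<cdot>\<^sub>m A + B) (i, j, Suc l) (i', j', Suc l') = entry mu q (c \<cdot>\<^sub>m A + B) (i, j, l) (i', j', l')"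
      using D l A(2) B(2) unfolding sn_conditions_def by (simp add: e)
  qed (use A(2) B(2) in \<open>auto simp: e sn_conditions_def\<close>)
qed

lemma subspace_matrix_prec_SN:
  "VectorSpace.subspace class_ring (matrix_prec mu q u ` (SN mu q u :: 'a :: field mat set))
     (module_mat TYPE('a) n n)"
proof -
  let ?M = "matrix_prec mu q u :: 'a mat \<Rightarrow> 'a mat"
  let ?S = "SN mu q u :: 'a mat set"
  have carr: "A \<in> carrier_mat n n" if "A \<in> ?S" for A using that by (simp add: SN_eq)
  have zero: "0\<^sub>m n n \<in> ?S" by (simp add: SN_eq sn_conditions_zero)
  have lin: "c \<cdot>\<^sub>m A + B \<in> ?S" if "A \<in> ?S" "B \<in> ?S" for A B c
    using that sn_conditions_linear[of A B c] by (simp add: SN_eq)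
  have add: "A + B \<in> ?S" if "A \<in> ?S" "B \<in> ?S" for A B
  proof -
    have "1 \<cdot>\<^sub>m A = A" by (intro eq_matI) simp_all
    then show ?thesis using lin[OF that, of 1] by simp
  qed
  have smult: "c \<cdot>\<^sub>m A \<in> ?S" if "A \<in> ?S" for A c
  proof -
    have "c \<cdot>\<^sub>m A + 0\<^sub>m n n = c \<cdot>\<^sub>m A" using carr[OF that] by simp
    then show ?thesis using lin[OF that zero, of c] by simp
  qed
  have "submodule class_ring (?M ` ?S) (module_mat TYPE('a) n n)"
  proof (rule submodule.intro)
    show "module class_ring (module_mat TYPE('a) n n)"
      using matrix_vs by (rule vectorspace.axioms)
    show "?M ` ?S \<subseteq> carrier (module_mat TYPE('a) n n)"
      using matrix_prec_carrier by (auto simp: module_mat_simps)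
    show "v \<oplus>\<^bsub>module_mat TYPE('a) n n\<^esub> w \<in> ?M ` ?S" if vw: "v \<in> ?M ` ?S" "w \<in> ?M ` ?S" for v w
    proof -
      obtain A B where AB: "A \<in> ?S" "B \<in> ?S" "v = ?M A" "w = ?M B" using vw by blast
      then have "v + w = ?M (A + B)" using matrix_prec_add[OF carr carr, of A B] by simp
      then show ?thesis using add AB by (simp add: module_mat_simps)
    qed
    show "\<zero>\<^bsub>module_mat TYPE('a) n n\<^esub> \<in> ?M ` ?S"
      using imageI[OF zero, of ?M, unfolded matrix_prec_zero] by (simp add: module_mat_simps)
    show "c \<odot>\<^bsub>module_mat TYPE('a) n n\<^esub> v \<in> ?M ` ?S" if "c \<in> carrier class_ring" and v: "v \<in> ?M ` ?S" for c v
    proof -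
      obtain A where A: "A \<in> ?S" "v = ?M A" using v by blast
      then have "c \<cdot>\<^sub>m v = ?M (c \<cdot>\<^sub>m A)" using matrix_prec_smult[OF carr, of A c] by simp
      then show ?thesis using smult A by (simp add: module_mat_simps)
    qed
  qed
  then show ?thesis using matrix_vs by (intro subspace.intro)
qed

end

theorem proposition3p1:
  fixes n u :: nat and mu :: "nat list" and q :: "nat \<Rightarrow> nat"
  assumes "infinite (UNIV :: 'a :: field set)"
    and "n \<ge> 1"
    and "is_partition mu n"
    and "distinct_part_indices mu q u"
  shows "(SN mu q u :: 'a mat set) =
      {A \<in> carrier_mat n n.
         strictly_upper_triangular (matrix_prec mu q u A) \<and>
         (\<forall>i j l i' j' l'. (i, j, l) \<in> Delta mu q u \<and> (i', j', l') \<in> Delta mu q u \<and>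
            int (mu_part mu (q i')) - int (mu_part mu (q i)) > int l' - int l \<and>
            int l' - int l > 0 \<longrightarrow>
            entry mu q A (i, j, l) (i', j', l') = 0) \<and>
         (\<forall>k \<in> {1..mu_part mu (q 1) - 1}. \<forall>h \<in> {1..k}.
            \<forall>a < dim_row (level_block mu q u A h k). \<forall>b < dim_col (level_block mu q u A h k).
              level_block mu q u A h k $$ (a, b) =
              level_block mu q u A (h - 1) (k - 1) $$ (a, b))}
    \<and> VectorSpace.subspace class_ring (matrix_prec mu q u ` (SN mu q u :: 'a mat set))
        (module_mat TYPE('a) n n)"
proof -
  interpret jordan_partition mu q u n
    using assms(3,4) by unfold_locales
  show ?thesis
    unfolding level_block_shift_iff strictly_upper_triangular_matrix_prec_iff
      sn_conditions_def[symmetric]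
    using SN_eq subspace_matrix_prec_SN by blast
qed

end
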